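(* Let $m$ be a positive integer, $S\subseteq\mathbb{F}_2^m$ and $\epsilon\in(0,1/2)$, and let $d=\dim(S)$. Then $\langle\mathcal{X}_{\overline{S}}^4\rangle\le 2^{2dm+8d^2}\big(1/(\epsilon(1-\epsilon))\big)^{2^d}$.
   Context: For $g:\{0,1\}^{\mathbb{F}_2^m}\to\mathbb{R}$, $\langle g\rangle=\sum_{z}\epsilon^{|z|}(1-\epsilon)^{2^m-|z|}g(z)$, the expectation under the product Bernoulli$(\epsilon)$ measure ($|z|$ is the Hamming weight). For $S\subseteq\mathbb{F}_2^m$, $\mathcal{X}_S(z)=\left(\frac{\epsilon}{1-\epsilon}\right)^{|S|/2}\left(-\frac{1-\epsilon}{\epsilon}\right)^{|\{x\in S:z_x=1\}|}$. $\dim(S)$ is the dimension of the linear span of $S$ in $\mathbb{F}_2^m$. $\overline{S}$ is the set of distinct images $\pi(S)$ of $S$ under invertible linear maps $\pi$ of $\mathbb{F}_2^m$, and $\mathcal{X}_{\overline{S}}=\sum_{S'\in\overline{S}}\mathcal{X}_{S'}$. *)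

theory Defs
  imports "HOL-Analysis.Analysis" "HOL-Library.Z2"
begin

text \<open>F_2^m is modelled as the type bit ^ 'm (m = CARD('m)), a vector space over
  the field bit via the library interpretation vec.  Configurations
  z : F_2^m -> {0,1} are predicates z :: bit^'m => bool (z x = True iff z_x = 1).\<close>

text \<open>Expectation under the product Bernoulli(eps) measure.\<close>
definition bern_expect :: "real \<Rightarrow> ((bit ^ 'm::finite \<Rightarrow> bool) \<Rightarrow> real) \<Rightarrow> real" where
  "bern_expect eps g =
     (\<Sum>z \<in> (UNIV :: (bit ^ 'm \<Rightarrow> bool) set).
        eps ^ card {x. z x} * (1 - eps) ^ (CARD(bit ^ 'm) - card {x. z x}) * g z)"

text \<open>The character X_S.\<close>
definition chi :: "real \<Rightarrow> (bit ^ 'm::finite) set \<Rightarrow> (bit ^ 'm \<Rightarrow> bool) \<Rightarrow> real" where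
  "chi eps S z =
     (eps / (1 - eps)) powr (real (card S) / 2) *
     (- ((1 - eps) / eps)) ^ card {x \<in> S. z x}"

text \<open>The orbit of S under invertible linear maps of F_2^m (set of distinct images).\<close>
definition orbit_GL :: "(bit ^ 'm::finite) set \<Rightarrow> (bit ^ 'm) set set" where
  "orbit_GL S = {\<pi> ` S | \<pi>. Vector_Spaces.linear (*s) (*s) \<pi> \<and> bij \<pi>}"

definition chi_orbit :: "real \<Rightarrow> (bit ^ 'm::finite) set \<Rightarrow> (bit ^ 'm \<Rightarrow> bool) \<Rightarrow> real" where
  "chi_orbit eps S z = (\<Sum>S' \<in> orbit_GL S. chi eps S' z)"

end

theory Submission
  imports Defs
begin

(* Expanding the fourth power, <X_{\bar S}^4> is the sum over quadruples (A_0, ..., A_3) of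
   images of S of <X_{A_0} X_{A_1} X_{A_2} X_{A_3}>.  Under the product measure this expectation
   factorises over the points x into moments of a single mean-zero coordinate, so it vanishes
   unless every point of each A_j also lies in some other A_i; otherwise AM-GM bounds it by the
   average of the <X_{A_j}^4> = <X_S^4> <= (1 / (eps (1 - eps)))^|S|, and |S| <= 2^d.
   For such a doubly covering quadruple every point lies in span A_0 \<inter> span A_1,
   span A_2 \<inter> span A_3 or span (A_0 \<union> A_1) \<inter> span (A_2 \<union> A_3), so Grassmann's formula
   shows that the union has dimension at most 2d.  The quadruple is therefore determined by 2d
   vectors spanning the union together with, for each A_j, the images of a basis of S in their
   span: at most 2^(2dm) (2^(2d^2))^4 choices. *)

lemma UNIV_bit: "(UNIV :: bit set) = {0, 1}"
  by (auto intro: bit.exhaust)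

instance bit :: finite
  by standard (simp add: UNIV_bit)

lemma card_bit: "CARD(bit) = 2"
  by (simp add: UNIV_bit)

lemma bern_weight_eq_prod:
  fixes z :: "'a::finite \<Rightarrow> bool"
  shows "p ^ card {x. z x} * (1 - p) ^ (CARD('a) - card {x. z x})
    = (\<Prod>x\<in>UNIV. if z x then p else 1 - p)"
proof -
  have "(\<Prod>x\<in>UNIV. if z x then p else 1 - p) = p ^ card {x. z x} * (1 - p) ^ card (- {x. z x})"
    by (simp add: prod.If_cases Int_def Collect_neg_eq)
  also have "card (- {x. z x}) = CARD('a) - card {x. z x}"
    by (simp add: Compl_eq_Diff_UNIV card_Diff_subset)
  finally show ?thesis ..
qed

lemma bern_expect_prod:
  "bern_expect p (\<lambda>z. \<Prod>x\<in>UNIV. G x (z x)) = (\<Prod>x\<in>UNIV. p * G x True + (1 - p) * G x False)"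
proof -
  have "bern_expect p (\<lambda>z. \<Prod>x\<in>UNIV. G x (z x))
      = (\<Sum>z\<in>UNIV \<rightarrow>\<^sub>E UNIV. \<Prod>x\<in>UNIV. (if z x then p else 1 - p) * G x (z x))"
    unfolding bern_expect_def bern_weight_eq_prod by (simp add: prod.distrib PiE_UNIV)
  also have "\<dots> = (\<Prod>x\<in>UNIV. \<Sum>b\<in>UNIV. (if b then p else 1 - p) * G x b)"
    by (rule prod_sum_PiE[symmetric]) auto
  finally show ?thesis
    by (simp add: UNIV_bool add.commute)
qed

lemma bern_expect_sum:
  "finite T \<Longrightarrow> bern_expect p (\<lambda>z. \<Sum>t\<in>T. f t z) = (\<Sum>t\<in>T. bern_expect p (f t))"
  unfolding bern_expect_def by (simp add: sum_distrib_left sum.swap[of _ T])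

lemma bern_expect_cmult: "bern_expect p (\<lambda>z. c * f z) = c * bern_expect p f"
  unfolding bern_expect_def by (simp add: sum_distrib_left mult_ac)

lemma bern_expect_abs_le:
  assumes "0 \<le> p" "p \<le> 1" and "\<And>z. \<bar>f z\<bar> \<le> g z"
  shows "\<bar>bern_expect p f\<bar> \<le> bern_expect p g"
  unfolding bern_expect_def
proof (rule order_trans[OF sum_abs sum_mono])
  fix z :: "bit ^ 'a \<Rightarrow> bool"
  let ?w = "p ^ card {x. z x} * (1 - p) ^ (CARD(bit ^ 'a) - card {x. z x})"
  have "0 \<le> ?w"
    using assms(1,2) by simp
  then show "\<bar>?w * f z\<bar> \<le> ?w * g z"
    by (metis abs_mult abs_of_nonneg mult_left_mono assms(3))
qed

definition chi_coord :: "real \<Rightarrow> bool \<Rightarrow> real" where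
  "chi_coord p b = (if b then - sqrt ((1 - p) / p) else sqrt (p / (1 - p)))"

definition coord_moment :: "real \<Rightarrow> nat \<Rightarrow> real" where
  "coord_moment p k = p * chi_coord p True ^ k + (1 - p) * chi_coord p False ^ k"

lemma chi_eq_prod_chi_coord:
  assumes "0 < p" "p < 1"
  shows "chi p A z = (\<Prod>x\<in>A. chi_coord p (z x))"
proof -
  define a where "a = sqrt (p / (1 - p))"
  have "a > 0"
    using assms by (simp add: a_def)
  have "(p / (1 - p)) powr (real (card A) / 2) = a ^ card A"
  proof -
    have "(p / (1 - p)) powr (real (card A) / 2) = ((p / (1 - p)) powr (1 / 2)) powr real (card A)"
      by (simp add: powr_powr)
    also have "\<dots> = a ^ card A"
      using assms \<open>a > 0\<close> by (simp add: a_def powr_half_sqrt powr_realpow)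
    finally show ?thesis .
  qed
  moreover have "chi_coord p b = a * (if b then - ((1 - p) / p) else 1)" for b
    using assms by (simp add: chi_coord_def a_def real_sqrt_divide field_simps)
  ultimately show ?thesis
    by (simp add: chi_def prod.distrib prod.If_cases Int_def conj_commute)
qed

lemma coord_moment_1:
  assumes "0 < p" "p < 1"
  shows "coord_moment p 1 = 0"
  using assms by (simp add: coord_moment_def chi_coord_def real_sqrt_divide field_simps)

lemma coord_moment_4_nonneg:
  assumes "0 \<le> p" "p \<le> 1"
  shows "0 \<le> coord_moment p 4"
  using assms by (simp add: coord_moment_def zero_le_even_power)

lemma coord_moment_4_le:
  assumes "0 < p" "p < 1"
  shows "coord_moment p 4 \<le> 1 / (p * (1 - p))"
proof -
  have sqrt_pow4: "sqrt x ^ 4 = x ^ 2" if "0 \<le> x" for x :: real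
  proof -
    have "sqrt x ^ 4 = (sqrt x ^ 2) ^ 2"
      by (simp flip: power_mult)
    then show ?thesis
      using that by simp
  qed
  have "coord_moment p 4 = p * ((1 - p) / p) ^ 2 + (1 - p) * (p / (1 - p)) ^ 2"
    using assms by (simp add: coord_moment_def chi_coord_def sqrt_pow4)
  also have "\<dots> = (1 - 3 * p * (1 - p)) / (p * (1 - p))"
  proof -
    have "p \<noteq> 0" "1 - p \<noteq> 0"
      using assms by auto
    then show ?thesis
      by (simp add: divide_simps power2_eq_square) algebra
  qed
  also have "\<dots> \<le> 1 / (p * (1 - p))"
    using assms by (intro divide_right_mono) auto
  finally show ?thesis .
qed

lemma bern_expect_prod_chi:
  assumes "0 < p" "p < 1" "finite J"
  shows "bern_expect p (\<lambda>z. \<Prod>j\<in>J. chi p (A j) z)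
    = (\<Prod>x\<in>UNIV. coord_moment p (card {j\<in>J. x \<in> A j}))"
proof -
  have "(\<Prod>j\<in>J. chi p (A j) z) = (\<Prod>x\<in>UNIV. chi_coord p (z x) ^ card {j\<in>J. x \<in> A j})" for z
  proof -
    have "(\<Prod>j\<in>J. chi p (A j) z) = (\<Prod>j\<in>J. \<Prod>x\<in>UNIV. if x \<in> A j then chi_coord p (z x) else 1)"
      using assms by (simp add: chi_eq_prod_chi_coord prod.If_cases Int_def)
    also have "\<dots> = (\<Prod>x\<in>UNIV. \<Prod>j\<in>J. if x \<in> A j then chi_coord p (z x) else 1)"
      by (rule prod.swap)
    also have "\<dots> = (\<Prod>x\<in>UNIV. chi_coord p (z x) ^ card {j\<in>J. x \<in> A j})"
      using assms by (simp add: prod.inter_filter[symmetric])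
    finally show ?thesis .
  qed
  then show ?thesis
    using bern_expect_prod[of p "\<lambda>x b. chi_coord p b ^ card {j\<in>J. x \<in> A j}"]
    by (simp add: coord_moment_def)
qed

definition doubly_covering :: "'i set \<Rightarrow> ('i \<Rightarrow> 'a set) \<Rightarrow> bool" where
  "doubly_covering J A \<longleftrightarrow> (\<forall>j\<in>J. \<forall>x\<in>A j. \<exists>i\<in>J. i \<noteq> j \<and> x \<in> A i)"

lemma bern_expect_prod_chi_eq_0:
  assumes "0 < p" "p < 1" "finite J" "\<not> doubly_covering J A"
  shows "bern_expect p (\<lambda>z. \<Prod>j\<in>J. chi p (A j) z) = 0"
proof -
  obtain j x where "j \<in> J" "x \<in> A j" "\<forall>i\<in>J. i \<noteq> j \<longrightarrow> x \<notin> A i"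
    using assms(4) unfolding doubly_covering_def by blast
  then have "card {i\<in>J. x \<in> A i} = 1"
    by (simp add: card_1_singleton_iff) blast
  then have "coord_moment p (card {i\<in>J. x \<in> A i}) = 0"
    using coord_moment_1[OF assms(1,2)] by simp
  then show ?thesis
    using assms(1-3) by (auto simp: bern_expect_prod_chi intro!: prod_zero)
qed

lemma bern_expect_chi_pow4:
  assumes "0 < p" "p < 1"
  shows "bern_expect p (\<lambda>z. chi p A z ^ 4) = coord_moment p 4 ^ card A"
proof -
  have "bern_expect p (\<lambda>z. chi p A z ^ 4) = bern_expect p (\<lambda>z. \<Prod>j<(4::nat). chi p A z)"
    by simp
  also have "\<dots> = (\<Prod>x\<in>UNIV. coord_moment p (card {j\<in>{..<4::nat}. x \<in> A}))"
    by (rule bern_expect_prod_chi[OF assms finite_lessThan])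
  also have "\<dots> = (\<Prod>x\<in>UNIV. if x \<in> A then coord_moment p 4 else 1)"
    by (rule prod.cong) (simp_all add: coord_moment_def)
  also have "\<dots> = coord_moment p 4 ^ card A"
    by (simp add: prod.If_cases Int_def)
  finally show ?thesis .
qed

lemma abs_mult4_le_sum_pow4:
  fixes a b c d :: real
  shows "\<bar>a * b * c * d\<bar> \<le> (a ^ 4 + b ^ 4 + c ^ 4 + d ^ 4) / 4"
proof -
  have two_mult: "2 * \<bar>x * y\<bar> \<le> x ^ 2 + y ^ 2" for x y :: real
    using sum_squares_bound[of "\<bar>x\<bar>" "\<bar>y\<bar>"] by (simp add: abs_mult)
  have "2 * \<bar>(a * b) * (c * d)\<bar> \<le> (a * b) ^ 2 + (c * d) ^ 2"
    by (rule two_mult)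
  moreover have "2 * \<bar>a ^ 2 * b ^ 2\<bar> \<le> (a ^ 2) ^ 2 + (b ^ 2) ^ 2"
    by (rule two_mult)
  moreover have "2 * \<bar>c ^ 2 * d ^ 2\<bar> \<le> (c ^ 2) ^ 2 + (d ^ 2) ^ 2"
    by (rule two_mult)
  ultimately show ?thesis
    by (simp add: power_mult_distrib mult.assoc flip: power_mult)
qed

lemma abs_bern_expect_prod4_chi_le:
  fixes A :: "nat \<Rightarrow> (bit ^ 'm::finite) set"
  assumes "0 < p" "p < 1" and card_A: "\<And>j. j < 4 \<Longrightarrow> card (A j) = k"
  shows "\<bar>bern_expect p (\<lambda>z. \<Prod>j<4. chi p (A j) z)\<bar> \<le> coord_moment p 4 ^ k"
proof -
  have "\<bar>\<Prod>j<4. chi p (A j) z\<bar> \<le> 1 / 4 * (\<Sum>j<4. chi p (A j) z ^ 4)" for z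
    using abs_mult4_le_sum_pow4[of "chi p (A 0) z" "chi p (A 1) z" "chi p (A 2) z" "chi p (A 3) z"]
    by (simp add: eval_nat_numeral mult_ac)
  then have "\<bar>bern_expect p (\<lambda>z. \<Prod>j<4. chi p (A j) z)\<bar>
      \<le> bern_expect p (\<lambda>z. 1 / 4 * (\<Sum>j<4. chi p (A j) z ^ 4))"
    using assms(1,2) by (intro bern_expect_abs_le) auto
  also have "\<dots> = 1 / 4 * bern_expect p (\<lambda>z. \<Sum>j<4. chi p (A j) z ^ 4)"
    by (rule bern_expect_cmult)
  also have "\<dots> = 1 / 4 * (\<Sum>j<4. coord_moment p 4 ^ card (A j))"
    using assms(1,2) by (simp add: bern_expect_sum bern_expect_chi_pow4)
  also have "\<dots> = coord_moment p 4 ^ k"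
    using card_A by simp
  finally show ?thesis .
qed

context finite_dimensional_vector_space
begin

lemma dim_Un_add_dim_span_Int: "dim (A \<union> B) + dim (span A \<inter> span B) = dim A + dim B"
  using dim_sums_Int[OF subspace_span subspace_span, of A B] by (simp flip: span_Un)

lemma dim_Un_le: "dim (A \<union> B) \<le> dim A + dim B"
  using dim_Un_add_dim_span_Int[of A B] by linarith

lemma dim_Union_doubly_covering_le:
  assumes cover: "doubly_covering {..<4::nat} A" and dim_A: "\<And>j. j < 4 \<Longrightarrow> dim (A j) \<le> d"
  shows "dim (\<Union>j<4. A j) \<le> 2 * d"
proof -
  define U where "U = (\<Union>j<4. A j)"
  let ?X = "span (A 0) \<inter> span (A 1)" and ?Y = "span (A 2) \<inter> span (A 3)"
    and ?Z = "span (A 0 \<union> A 1) \<inter> span (A 2 \<union> A 3)"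
  have U_eq: "U = (A 0 \<union> A 1) \<union> (A 2 \<union> A 3)"
    by (auto simp: U_def eval_nat_numeral less_Suc_eq)
  have "U \<subseteq> ?X \<union> ?Y \<union> ?Z"
  proof
    fix x assume "x \<in> U"
    then obtain j i where "j < 4" "i < 4" "i \<noteq> j" "x \<in> A j" "x \<in> A i"
      using cover unfolding U_def doubly_covering_def by blast
    moreover from \<open>j < 4\<close> \<open>i < 4\<close> have "j \<in> {0, 1, 2, 3}" "i \<in> {0, 1, 2, 3}"
      by auto
    ultimately show "x \<in> ?X \<union> ?Y \<union> ?Z"
      by (auto intro: span_base)
  qed
  then have "dim U \<le> dim (?X \<union> ?Y \<union> ?Z)"
    by (rule dim_subset)
  also have "\<dots> \<le> dim ?X + dim ?Y + dim ?Z"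
    using dim_Un_le[of "?X \<union> ?Y" ?Z] dim_Un_le[of ?X ?Y] by linarith
  finally have "dim U \<le> dim ?X + dim ?Y + dim ?Z" .
  moreover have "dim U + dim ?Z = dim (A 0 \<union> A 1) + dim (A 2 \<union> A 3)"
    unfolding U_eq by (rule dim_Un_add_dim_span_Int)
  moreover have "dim (A 0 \<union> A 1) + dim ?X = dim (A 0) + dim (A 1)"
    and "dim (A 2 \<union> A 3) + dim ?Y = dim (A 2) + dim (A 3)"
    by (rule dim_Un_add_dim_span_Int)+
  moreover have "dim (A 0) \<le> d" "dim (A 1) \<le> d" "dim (A 2) \<le> d" "dim (A 3) \<le> d"
    by (simp_all add: dim_A)
  ultimately show ?thesis
    unfolding U_def by linarith
qed

lemma ex_spanning_family:
  assumes "dim U \<le> n"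
  shows "\<exists>w\<in>{..<n} \<rightarrow>\<^sub>E UNIV. U \<subseteq> span (w ` {..<n})"
proof -
  obtain B where B: "B \<subseteq> U" "independent B" "U \<subseteq> span B" "card B = dim U"
    using basis_exists by blast
  obtain h where h: "bij_betw h {0..<card B} B"
    using ex_bij_betw_nat_finite[OF finiteI_independent[OF B(2)]] by blast
  define w where "w = (\<lambda>i\<in>{..<n}. if i < card B then h i else 0)"
  have "B \<subseteq> w ` {..<n}"
  proof
    fix b assume "b \<in> B"
    then obtain i where "i < card B" "b = h i"
      using h by (force simp: bij_betw_def)
    then show "b \<in> w ` {..<n}"
      using assms B(4) by (auto simp: w_def intro!: image_eqI[of _ _ i])
  qed
  then have "U \<subseteq> span (w ` {..<n})"
    using B(3) span_mono by blast
  moreover have "w \<in> {..<n} \<rightarrow>\<^sub>E UNIV"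
    by (simp add: w_def)
  ultimately show ?thesis
    by blast
qed

end

lemma card_vec_span_le:
  fixes B :: "('a::{field,finite} ^ 'n::finite) set"
  shows "card (vec.span B) \<le> CARD('a) ^ card B"
proof -
  let ?comb = "\<lambda>u. \<Sum>v\<in>B. u v *s v"
  have "vec.span B \<subseteq> ?comb ` (B \<rightarrow>\<^sub>E UNIV)"
  proof
    fix x assume "x \<in> vec.span B"
    then obtain u where "x = ?comb u"
      using vec.span_finite[of B] by auto
    then have "x = ?comb (restrict u B)"
      by simp
    moreover have "restrict u B \<in> B \<rightarrow>\<^sub>E UNIV"
      by simp
    ultimately show "x \<in> ?comb ` (B \<rightarrow>\<^sub>E UNIV)"
      by (rule image_eqI)
  qed
  then have "card (vec.span B) \<le> card (?comb ` (B \<rightarrow>\<^sub>E UNIV))"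
    by (rule card_mono[rotated]) simp
  also have "\<dots> \<le> card (B \<rightarrow>\<^sub>E (UNIV :: 'a set))"
    by (rule card_image_le) (simp add: finite_PiE)
  finally show ?thesis
    by (simp add: card_PiE)
qed

lemma card_le_CARD_pow_dim:
  fixes S :: "('a::{field,finite} ^ 'n::finite) set"
  shows "card S \<le> CARD('a) ^ vec.dim S"
proof -
  obtain B where "S \<subseteq> vec.span B" "card B = vec.dim S"
    using vec.basis_exists by blast
  then have "card S \<le> card (vec.span B)"
    by (intro card_mono) simp_all
  also have "\<dots> \<le> CARD('a) ^ vec.dim S"
    using card_vec_span_le[of B] \<open>card B = vec.dim S\<close> by simp
  finally show ?thesis .
qed

lemma card_linear_images_le:
  fixes S :: "('a::field ^ 'n::finite) set" and V :: "('a ^ 'n) set"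
  assumes "finite V"
  shows "card {\<pi> ` S | \<pi>. Vector_Spaces.linear (*s) (*s) \<pi> \<and> \<pi> ` S \<subseteq> V} \<le> card V ^ vec.dim S"
proof -
  obtain B where B: "B \<subseteq> S" "vec.independent B" "S \<subseteq> vec.span B" "card B = vec.dim S"
    using vec.basis_exists by blast
  have "finite B"
    using B(2) by (rule vec.finiteI_independent)
  have "{\<pi> ` S | \<pi>. Vector_Spaces.linear (*s) (*s) \<pi> \<and> \<pi> ` S \<subseteq> V}
      \<subseteq> (\<lambda>f. vec.construct B f ` S) ` (B \<rightarrow>\<^sub>E V)"
  proof clarify
    fix \<pi> :: "'a ^ 'n \<Rightarrow> 'a ^ 'n"
    assume lin: "Vector_Spaces.linear (*s) (*s) \<pi>" and "\<pi> ` S \<subseteq> V"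
    have "\<pi> ` S = vec.construct B (restrict \<pi> B) ` S"
    proof (rule image_cong[OF refl])
      fix s assume "s \<in> S"
      show "\<pi> s = vec.construct B (restrict \<pi> B) s"
      proof (rule vec.linear_eq_on[OF lin vec.linear_construct[OF B(2)]])
        show "s \<in> vec.span B"
          using \<open>s \<in> S\<close> B(3) by blast
        show "\<pi> b = vec.construct B (restrict \<pi> B) b" if "b \<in> B" for b
          using that by (simp add: vec.construct_basis[OF B(2)])
      qed
    qed
    moreover have "restrict \<pi> B \<in> B \<rightarrow>\<^sub>E V"
      using B(1) \<open>\<pi> ` S \<subseteq> V\<close> by auto
    ultimately show "\<pi> ` S \<in> (\<lambda>f. vec.construct B f ` S) ` (B \<rightarrow>\<^sub>E V)"
      by (rule image_eqI)
  qed
  moreover have "finite (B \<rightarrow>\<^sub>E V)"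
    using \<open>finite B\<close> assms by (simp add: finite_PiE)
  ultimately have "card {\<pi> ` S | \<pi>. Vector_Spaces.linear (*s) (*s) \<pi> \<and> \<pi> ` S \<subseteq> V} \<le> card (B \<rightarrow>\<^sub>E V)"
    by (intro surj_card_le)
  also have "\<dots> = card V ^ vec.dim S"
    using B(4) \<open>finite B\<close> by (simp add: card_PiE)
  finally show ?thesis .
qed

lemma sum_power_eq_sum_PiE:
  fixes f :: "'a \<Rightarrow> 'b::comm_semiring_1"
  assumes "finite A"
  shows "(\<Sum>x\<in>A. f x) ^ n = (\<Sum>t\<in>{..<n} \<rightarrow>\<^sub>E A. \<Prod>j<n. f (t j))"
  using prod_sum_PiE[of "{..<n}" "\<lambda>_. A" "\<lambda>_. f"] assms by simp

lemma card_orbit_GL: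
  assumes "A \<in> orbit_GL S"
  shows "card A = card S"
proof -
  obtain \<pi> where "bij \<pi>" "A = \<pi> ` S"
    using assms unfolding orbit_GL_def by blast
  then show ?thesis
    by (metis bij_is_inj card_image inj_on_subset subset_UNIV)
qed

lemma doubly_covering_linear_images_in_span:
  fixes S :: "('a::field ^ 'n::finite) set" and t :: "nat \<Rightarrow> ('a ^ 'n) set"
  assumes images: "\<And>j. j < 4 \<Longrightarrow> \<exists>\<pi>. Vector_Spaces.linear (*s) (*s) \<pi> \<and> t j = \<pi> ` S"
    and cover: "doubly_covering {..<4} t"
  obtains w where "w \<in> {..<2 * vec.dim S} \<rightarrow>\<^sub>E UNIV"
    and "\<And>j. j < 4 \<Longrightarrow> t j \<subseteq> vec.span (w ` {..<2 * vec.dim S})"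
proof -
  have "vec.dim (t j) \<le> vec.dim S" if "j < 4" for j
    using images[OF that] vec.dim_image_le by force
  then have "vec.dim (\<Union>j<4. t j) \<le> 2 * vec.dim S"
    by (rule vec.dim_Union_doubly_covering_le[OF cover])
  then obtain w where "w \<in> {..<2 * vec.dim S} \<rightarrow>\<^sub>E UNIV" "(\<Union>j<4. t j) \<subseteq> vec.span (w ` {..<2 * vec.dim S})"
    by (blast dest: vec.ex_spanning_family)
  then show ?thesis
    using that by blast
qed

lemma card_doubly_covering_orbit_tuples_le:
  fixes S :: "(bit ^ 'm::finite) set"
  defines "d \<equiv> vec.dim S"
  shows "card {t \<in> {..<4::nat} \<rightarrow>\<^sub>E orbit_GL S. doubly_covering {..<4} t}
    \<le> 2 ^ (2 * d * CARD('m) + 8 * d ^ 2)"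
proof -
  define I where "I = {..<2 * d}"
  define W where "W = I \<rightarrow>\<^sub>E (UNIV :: (bit ^ 'm) set)"
  define L where "L w = {\<pi> ` S | \<pi>. Vector_Spaces.linear (*s) (*s) \<pi> \<and> \<pi> ` S \<subseteq> vec.span (w ` I)}"
    for w :: "nat \<Rightarrow> bit ^ 'm"
  have "finite W"
    unfolding W_def I_def by (intro finite_PiE) auto
  have "{t \<in> {..<4::nat} \<rightarrow>\<^sub>E orbit_GL S. doubly_covering {..<4} t} \<subseteq> (\<Union>w\<in>W. {..<4} \<rightarrow>\<^sub>E L w)"
  proof clarify
    fix t assume t: "t \<in> {..<4} \<rightarrow>\<^sub>E orbit_GL S" "doubly_covering {..<4::nat} t"
    have images: "\<exists>\<pi>. Vector_Spaces.linear (*s) (*s) \<pi> \<and> t j = \<pi> ` S" if "j < 4" for j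
      using PiE_mem[OF t(1)] that unfolding orbit_GL_def by blast
    obtain w where "w \<in> W" and span_w: "\<And>j. j < 4 \<Longrightarrow> t j \<subseteq> vec.span (w ` I)"
      using doubly_covering_linear_images_in_span[OF images t(2)] unfolding W_def I_def d_def by blast
    have "t j \<in> L w" if "j < 4" for j
      using images[OF that] span_w[OF that] unfolding L_def by blast
    then have "t \<in> {..<4} \<rightarrow>\<^sub>E L w"
      using t(1) by (auto simp: PiE_iff)
    with \<open>w \<in> W\<close> show "t \<in> (\<Union>w\<in>W. {..<4} \<rightarrow>\<^sub>E L w)"
      by blast
  qed
  then have "card {t \<in> {..<4::nat} \<rightarrow>\<^sub>E orbit_GL S. doubly_covering {..<4} t}
      \<le> card (\<Union>w\<in>W. {..<4::nat} \<rightarrow>\<^sub>E L w)"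
    by (rule card_mono[rotated]) (use \<open>finite W\<close> in \<open>auto intro!: finite_PiE\<close>)
  also have "\<dots> \<le> (\<Sum>w\<in>W. card ({..<4::nat} \<rightarrow>\<^sub>E L w))"
    by (rule card_UN_le[OF \<open>finite W\<close>])
  also have "\<dots> \<le> (\<Sum>w\<in>W. (((2::nat) ^ (2 * d)) ^ d) ^ 4)"
  proof (rule sum_mono)
    fix w assume "w \<in> W"
    have "card (L w) \<le> card (vec.span (w ` I)) ^ d"
      unfolding L_def d_def by (rule card_linear_images_le) simp
    also have "\<dots> \<le> (2 ^ card (w ` I)) ^ d"
      using card_vec_span_le[of "w ` I"] by (simp add: card_bit power_mono)
    also have "\<dots> \<le> (2 ^ (2 * d)) ^ d"
      using card_image_le[of I w] by (intro power_mono power_increasing) (simp_all add: I_def)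
    finally show "card ({..<4::nat} \<rightarrow>\<^sub>E L w) \<le> ((2 ^ (2 * d)) ^ d) ^ 4"
      by (simp add: card_PiE power_mono)
  qed
  also have "\<dots> = (2 ^ CARD('m)) ^ (2 * d) * ((2 ^ (2 * d)) ^ d) ^ 4"
    by (simp add: W_def I_def card_PiE CARD_vec card_bit)
  also have "\<dots> = 2 ^ (2 * d * CARD('m) + 8 * d ^ 2)"
    by (simp add: power_add power2_eq_square mult_ac flip: power_mult)
  finally show ?thesis .
qed

lemma bern_expect_prod4_chi_orbit_le:
  fixes S :: "(bit ^ 'm::finite) set" and t :: "nat \<Rightarrow> (bit ^ 'm) set"
  assumes "0 < p" "p < 1" "t \<in> {..<4} \<rightarrow>\<^sub>E orbit_GL S"
  shows "bern_expect p (\<lambda>z. \<Prod>j<4. chi p (t j) z) \<le> (1 / (p * (1 - p))) ^ 2 ^ vec.dim S"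
proof -
  have "0 < p * (1 - p)" "p * (1 - p) \<le> 1"
    using assms(1,2) by (simp_all add: mult_le_one)
  then have "1 \<le> 1 / (p * (1 - p))"
    by simp
  have "card (t j) = card S" if "j < 4" for j
    using assms(3) that by (auto intro: card_orbit_GL)
  then have "\<bar>bern_expect p (\<lambda>z. \<Prod>j<4. chi p (t j) z)\<bar> \<le> coord_moment p 4 ^ card S"
    by (rule abs_bern_expect_prod4_chi_le[OF assms(1,2)])
  then have "bern_expect p (\<lambda>z. \<Prod>j<4. chi p (t j) z) \<le> coord_moment p 4 ^ card S"
    by simp
  also have "\<dots> \<le> (1 / (p * (1 - p))) ^ card S"
    using assms(1,2) by (intro power_mono coord_moment_4_le coord_moment_4_nonneg) auto
  also have "\<dots> \<le> (1 / (p * (1 - p))) ^ 2 ^ vec.dim S"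
    using \<open>1 \<le> 1 / (p * (1 - p))\<close> card_le_CARD_pow_dim[of S] by (intro power_increasing) (simp_all add: card_bit)
  finally show ?thesis .
qed

theorem lemma5:
  fixes S :: "(bit ^ 'm::finite) set" and eps :: real
  assumes "0 < eps" and "eps < 1/2"
  defines "d \<equiv> vec.dim S" and "m \<equiv> CARD('m)"
  shows "bern_expect eps (\<lambda>z. (chi_orbit eps S z) ^ 4)
           \<le> 2 ^ (2 * d * m + 8 * d ^ 2) * (1 / (eps * (1 - eps))) ^ (2 ^ d)"
proof -
  have eps: "0 < eps" "eps < 1"
    using assms(1,2) by simp_all
  define T where "T = {..<4::nat} \<rightarrow>\<^sub>E orbit_GL S"
  define G where "G = {t \<in> T. doubly_covering {..<4} t}"
  define K where "K = (1 / (eps * (1 - eps))) ^ (2 ^ d)"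
  have "bern_expect eps (\<lambda>z. (chi_orbit eps S z) ^ 4)
      = (\<Sum>t\<in>T. bern_expect eps (\<lambda>z. \<Prod>j<4. chi eps (t j) z))"
    by (simp add: chi_orbit_def sum_power_eq_sum_PiE bern_expect_sum T_def finite_PiE)
  also have "\<dots> = (\<Sum>t\<in>G. bern_expect eps (\<lambda>z. \<Prod>j<4. chi eps (t j) z))"
    using bern_expect_prod_chi_eq_0[OF eps]
    by (intro sum.mono_neutral_right) (auto simp: T_def G_def finite_PiE)
  also have "\<dots> \<le> (\<Sum>t\<in>G. K)"
    unfolding K_def d_def G_def T_def by (intro sum_mono bern_expect_prod4_chi_orbit_le[OF eps]) auto
  also have "\<dots> = real (card G) * K"
    by simp
  also have "\<dots> \<le> 2 ^ (2 * d * m + 8 * d ^ 2) * K"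
  proof (rule mult_right_mono)
    have "card G \<le> 2 ^ (2 * d * m + 8 * d ^ 2)"
      unfolding G_def T_def d_def m_def by (rule card_doubly_covering_orbit_tuples_le)
    then show "real (card G) \<le> 2 ^ (2 * d * m + 8 * d ^ 2)"
      using of_nat_mono by fastforce
    show "0 \<le> K"
      using eps by (simp add: K_def)
  qed
  finally show ?thesis
    unfolding K_def .
qed

end
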